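(* Let $G$ be a finite solvable group whose character degree graph $\Delta(G)$ has $n$ vertices. Assume that $\Delta(G)$ has diameter $3$, with Lewis' partition $\rho(G)=\rho_1\cup\rho_2\cup\rho_3\cup\rho_4$, and suppose that $\Delta(G)$ contains a cut vertex. Then: (1) if $|\rho_1|=1$, the metric dimension of $\Delta(G)$ is $n-3$; (2) if $|\rho_1|\ge 2$, the metric dimension of $\Delta(G)$ is $n-4$.
   Context: For a finite group $G$, $\mathrm{cd}(G)=\{\chi(1)\mid \chi\in\mathrm{Irr}(G)\}$ is the set of degrees of the irreducible complex characters of $G$, and $\rho(G)$ is the set of primes dividing some degree in $\mathrm{cd}(G)$. The character degree graph $\Delta(G)$ is the simple undirected graph with vertex set $\rho(G)$ in which two distinct primes $p,q$ are adjacent if $pq$ divides some $a\in\mathrm{cd}(G)$. A cut vertex of a graph is a vertex whose removal increases the number of connected components. Lewis' (diameter three) partition: when $G$ is a finite solvable group and $\Delta(G)$ has diameter $3$, $\rho(G)$ is partitioned into four disjoint nonempty sets $\rho_1,\rho_2,\rho_3,\rho_4$ arising as follows from suitable vertices $r,s$ at distance $3$. The set $\rho_4$ consists of all vertices at distance $3$ from $r$; $\rho_3$ consists of all vertices at distance $2$ from $r$; $\rho_2$ consists of all vertices adjacent to $r$ and adjacent to some prime in $\rho_3$; $\rho_1$ consists of $r$ together with all vertices adjacent to $r$ and not adjacent to any vertex in $\rho_3$. The partition has the following established properties: $|\rho_3|\ge 3$; no vertex of $\rho_1$ is adjacent to any vertex of $\rho_3\cup\rho_4$; no vertex of $\rho_4$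 is adjacent to any vertex of $\rho_1\cup\rho_2$; every vertex of $\rho_2$ is adjacent to some vertex of $\rho_3$ and vice versa; and $\rho_1\cup\rho_2$ and $\rho_3\cup\rho_4$ both induce complete subgraphs of $\Delta(G)$. For a graph $\Gamma$ with graph distance $d$ and a subset $W=\{v_1,\dots,v_k\}\subseteq V(\Gamma)$, the metric $W$-representation of a vertex $v$ is $r(v\mid W)=(d(v,v_1),\dots,d(v,v_k))$. The set $W$ is a resolving set if distinct vertices have distinct metric $W$-representations. The metric dimension $\dim(\Gamma)$ is the smallest cardinality of a resolving set. *)

theory Defs
  imports
    Complex_Main
    "HOL-Algebra.Solvable_Groups"
    "HOL-Computational_Algebra.Primes"
    "Jordan_Normal_Form.VS_Connect"
    "Graph_Theory.Graph_Theory"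
begin

section \<open>Irreducible complex characters\<close>

definition GL :: "nat \<Rightarrow> complex mat monoid" where
  "GL n = units_of (ring_mat TYPE(complex) n ())"

definition representation ::
    "('a, 'b) monoid_scheme \<Rightarrow> nat \<Rightarrow> ('a \<Rightarrow> complex mat) \<Rightarrow> bool" where
  "representation G n R \<longleftrightarrow> R \<in> hom G (GL n)"

definition irreducible_representation ::
    "('a, 'b) monoid_scheme \<Rightarrow> nat \<Rightarrow> ('a \<Rightarrow> complex mat) \<Rightarrow> bool" where
  "irreducible_representation G n R \<longleftrightarrow>
     representation G n R \<and> 0 < n \<and>
     (\<forall>W. VectorSpace.subspace class_ring W (module_vec TYPE(complex) n) \<and>
          (\<forall>g\<in>carrier G. \<forall>w\<in>W. R g *\<^sub>v w \<in> W)
          \<longrightarrow> W = {0\<^sub>v n} \<or> W = carrier_vec n)"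

definition mat_trace :: "complex mat \<Rightarrow> complex" where
  "mat_trace A = (\<Sum>i<dim_row A. A $$ (i, i))"

definition character_of ::
    "('a, 'b) monoid_scheme \<Rightarrow> ('a \<Rightarrow> complex mat) \<Rightarrow> 'a \<Rightarrow> complex" where
  "character_of G R = (\<lambda>g\<in>carrier G. mat_trace (R g))"

definition Irr :: "('a, 'b) monoid_scheme \<Rightarrow> ('a \<Rightarrow> complex) set" where
  "Irr G = {character_of G R | n R. irreducible_representation G n R}"

definition cd :: "('a, 'b) monoid_scheme \<Rightarrow> nat set" where
  "cd G = {d. \<exists>\<chi>\<in>Irr G. \<chi> \<one>\<^bsub>G\<^esub> = of_nat d}"

section \<open>The character degree graph\<close>

definition degree_primes :: "('a, 'b) monoid_scheme \<Rightarrow> nat set" where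
  "degree_primes G = {p. prime p \<and> (\<exists>a\<in>cd G. p dvd a)}"

text \<open>Simple undirected graphs are represented as loop-free symmetric digraphs: an edge
  between \<open>p\<close> and \<open>q\<close> is the pair of arcs \<open>(p, q)\<close>, \<open>(q, p)\<close>.\<close>

definition degree_graph :: "('a, 'b) monoid_scheme \<Rightarrow> nat pair_pre_digraph" where
  "degree_graph G =
     \<lparr> pverts = degree_primes G,
       parcs = {(p, q). p \<in> degree_primes G \<and> q \<in> degree_primes G \<and> p \<noteq> q \<and>
                        (\<exists>a\<in>cd G. p * q dvd a)} \<rparr>"

lemma pair_bidirected_digraph_degree_graph: "pair_bidirected_digraph (degree_graph G)"
proof
  show "symmetric (with_proj (degree_graph G))"
    by (auto simp: symmetric_def degree_graph_def mult.commute intro!: symI)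
qed (auto simp: degree_graph_def)

section \<open>Distance, cut vertices and metric dimension\<close>

definition gdist :: "'v pair_pre_digraph \<Rightarrow> 'v \<Rightarrow> 'v \<Rightarrow> ereal" where
  "gdist \<Gamma> u v = wf_digraph.\<mu> (with_proj \<Gamma>) (\<lambda>_. 1) u v"

definition diameter :: "'v pair_pre_digraph \<Rightarrow> ereal" where
  "diameter \<Gamma> = (SUP u\<in>pverts \<Gamma>. SUP v\<in>pverts \<Gamma>. gdist \<Gamma> u v)"

text \<open>In a symmetric digraph the strongly connected components are the connected components
  of the underlying undirected graph.\<close>

definition cut_vertex :: "'v pair_pre_digraph \<Rightarrow> 'v \<Rightarrow> bool" where
  "cut_vertex \<Gamma> v \<longleftrightarrow> v \<in> pverts \<Gamma> \<and>
     card (pre_digraph.sccs_verts (with_proj \<Gamma>)) <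
     card (pre_digraph.sccs_verts (pre_digraph.del_vert (with_proj \<Gamma>) v))"

definition metric_rep :: "'v pair_pre_digraph \<Rightarrow> 'v set \<Rightarrow> 'v \<Rightarrow> 'v \<Rightarrow> ereal" where
  "metric_rep \<Gamma> W v = (\<lambda>w\<in>W. gdist \<Gamma> v w)"

definition resolving_set :: "'v pair_pre_digraph \<Rightarrow> 'v set \<Rightarrow> bool" where
  "resolving_set \<Gamma> W \<longleftrightarrow>
     finite W \<and> W \<subseteq> pverts \<Gamma> \<and> inj_on (metric_rep \<Gamma> W) (pverts \<Gamma>)"

definition metric_dim :: "'v pair_pre_digraph \<Rightarrow> nat" where
  "metric_dim \<Gamma> = (LEAST k. \<exists>W. resolving_set \<Gamma> W \<and> card W = k)"

section \<open>Lewis' partition\<close>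

definition induces_complete :: "'v pair_pre_digraph \<Rightarrow> 'v set \<Rightarrow> bool" where
  "induces_complete \<Gamma> S \<longleftrightarrow> (\<forall>u\<in>S. \<forall>v\<in>S. u \<noteq> v \<longrightarrow> (u, v) \<in> parcs \<Gamma>)"

definition lewis_sets ::
    "'v pair_pre_digraph \<Rightarrow> 'v \<Rightarrow> 'v \<Rightarrow> 'v set \<Rightarrow> 'v set \<Rightarrow> 'v set \<Rightarrow> 'v set \<Rightarrow> bool" where
  "lewis_sets \<Gamma> r s \<rho>1 \<rho>2 \<rho>3 \<rho>4 \<longleftrightarrow>
     r \<in> pverts \<Gamma> \<and> s \<in> pverts \<Gamma> \<and> gdist \<Gamma> r s = 3 \<and>
     \<rho>4 = {v \<in> pverts \<Gamma>. gdist \<Gamma> r v = 3} \<and>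
     \<rho>3 = {v \<in> pverts \<Gamma>. gdist \<Gamma> r v = 2} \<and>
     \<rho>2 = {v \<in> pverts \<Gamma>. (r, v) \<in> parcs \<Gamma> \<and> (\<exists>w\<in>\<rho>3. (v, w) \<in> parcs \<Gamma>)} \<and>
     \<rho>1 = insert r {v \<in> pverts \<Gamma>. (r, v) \<in> parcs \<Gamma> \<and> (\<forall>w\<in>\<rho>3. (v, w) \<notin> parcs \<Gamma>)}"

text \<open>Not every pair \<open>r, s\<close> at distance \<open>3\<close> gives Lewis' partition: interchanging \<open>r\<close> and \<open>s\<close>
  essentially reverses the order of the four sets. The pair is suitable if the resulting sets
  have the properties established by Lewis, in particular \<open>3 \<le> card \<rho>3\<close>, which distinguishes
  \<open>\<rho>3\<close> from \<open>\<rho>2\<close> when the graph has a cut vertex.\<close>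

definition lewis_partition ::
    "'v pair_pre_digraph \<Rightarrow> 'v set \<Rightarrow> 'v set \<Rightarrow> 'v set \<Rightarrow> 'v set \<Rightarrow> bool" where
  "lewis_partition \<Gamma> \<rho>1 \<rho>2 \<rho>3 \<rho>4 \<longleftrightarrow>
     (\<exists>r s. lewis_sets \<Gamma> r s \<rho>1 \<rho>2 \<rho>3 \<rho>4) \<and>
     pverts \<Gamma> = \<rho>1 \<union> \<rho>2 \<union> \<rho>3 \<union> \<rho>4 \<and>
     \<rho>1 \<inter> \<rho>2 = {} \<and> \<rho>1 \<inter> \<rho>3 = {} \<and> \<rho>1 \<inter> \<rho>4 = {} \<and>
     \<rho>2 \<inter> \<rho>3 = {} \<and> \<rho>2 \<inter> \<rho>4 = {} \<and> \<rho>3 \<inter> \<rho>4 = {} \<and>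
     \<rho>1 \<noteq> {} \<and> \<rho>2 \<noteq> {} \<and> \<rho>3 \<noteq> {} \<and> \<rho>4 \<noteq> {} \<and>
     3 \<le> card \<rho>3 \<and>
     (\<forall>u\<in>\<rho>1. \<forall>v\<in>\<rho>3 \<union> \<rho>4. (u, v) \<notin> parcs \<Gamma>) \<and>
     (\<forall>u\<in>\<rho>4. \<forall>v\<in>\<rho>1 \<union> \<rho>2. (u, v) \<notin> parcs \<Gamma>) \<and>
     (\<forall>u\<in>\<rho>2. \<exists>v\<in>\<rho>3. (u, v) \<in> parcs \<Gamma>) \<and>
     (\<forall>v\<in>\<rho>3. \<exists>u\<in>\<rho>2. (v, u) \<in> parcs \<Gamma>) \<and>
     induces_complete \<Gamma> (\<rho>1 \<union> \<rho>2) \<and>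
     induces_complete \<Gamma> (\<rho>3 \<union> \<rho>4)"

end

theory Submission
  imports Defs
begin

text \<open>A cut vertex \<open>v\<close> must meet every edge between the cliques \<open>\<rho>1 \<union> \<rho>2\<close> and \<open>\<rho>3 \<union> \<rho>4\<close>, and since
  \<open>\<rho>3\<close> has at least two vertices, all with a neighbour in \<open>\<rho>2\<close>, this forces \<open>\<rho>2 = {v}\<close>. The graph is
  then the blow-up of a path with four vertices into the cliques \<open>\<rho>1, {v}, \<rho>3, \<rho>4\<close>. Each of them is a
  twin class, so a resolving set misses at most one vertex of each. Missing exactly one of each
  works as long as \<open>\<rho>1\<close> still contributes a vertex; if \<open>\<rho>1\<close> is a singleton, no vertex is left that
  separates \<open>\<rho>3\<close> from \<open>\<rho>4\<close>. The group itself only enters through the finiteness of \<open>\<rho>(G)\<close>: an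
  irreducible degree is at most the group order.\<close>

section \<open>Irreducible degrees are bounded by the group order\<close>

text \<open>The vectors that \<open>A\<close> maps into the span form a submodule. It contains
  \<open>S\<close>, hence also the span of \<open>S\<close>.\<close>

lemma mult_mat_vec_span_invariant:
  fixes A :: "complex mat"
  assumes A: "A \<in> carrier_mat n n" and S: "S \<subseteq> carrier_vec n"
    and inv: "\<And>w. w \<in> S \<Longrightarrow> A *\<^sub>v w \<in> S"
    and w: "w \<in> LinearCombinations.module.span class_ring (module_vec TYPE(complex) n) S"
  shows "A *\<^sub>v w \<in> LinearCombinations.module.span class_ring (module_vec TYPE(complex) n) S"
proof -
  interpret vec_space "TYPE(complex)" n .
  interpret sub: submodule class_ring "span S" V
    using span_is_submodule S by simp
  have "submodule class_ring {x \<in> carrier_vec n. A *\<^sub>v x \<in> span S} V"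
  proof
    fix x y assume "x \<in> {x \<in> carrier_vec n. A *\<^sub>v x \<in> span S}" "y \<in> {x \<in> carrier_vec n. A *\<^sub>v x \<in> span S}"
    then show "x \<oplus>\<^bsub>V\<^esub> y \<in> {x \<in> carrier_vec n. A *\<^sub>v x \<in> span S}"
      using sub.m_closed A by (auto simp: mult_add_distrib_mat_vec)
  next
    fix c x assume "x \<in> {x \<in> carrier_vec n. A *\<^sub>v x \<in> span S}"
    then show "c \<odot>\<^bsub>V\<^esub> x \<in> {x \<in> carrier_vec n. A *\<^sub>v x \<in> span S}"
      using sub.smult_closed[of c] A by (auto simp: mult_mat_vec class_ring_simps)
  next
    have "A *\<^sub>v 0\<^sub>v n = 0\<^sub>v n" using A by auto
    then show "\<zero>\<^bsub>V\<^esub> \<in> {x \<in> carrier_vec n. A *\<^sub>v x \<in> span S}"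
      using sub.zero_closed by simp
  qed auto
  moreover have "S \<subseteq> {x \<in> carrier_vec n. A *\<^sub>v x \<in> span S}"
    using S inv in_own_span[of S] by auto
  ultimately have "span S \<subseteq> {x \<in> carrier_vec n. A *\<^sub>v x \<in> span S}"
    by (intro span_is_subset) auto
  then show ?thesis using w by blast
qed

lemma representation_carrier_mat:
  assumes "representation G n R" "g \<in> carrier G"
  shows "R g \<in> carrier_mat n n"
  using assms
  by (auto simp: representation_def GL_def hom_def units_of_def Units_def ring_mat_simps)

lemma representation_mult:
  assumes "representation G n R" "g \<in> carrier G" "h \<in> carrier G"
  shows "R (g \<otimes>\<^bsub>G\<^esub> h) = R g * R h"
  using assms by (auto simp: representation_def GL_def hom_def units_of_def ring_mat_simps)

lemma representation_one:
  assumes "group G" "representation G n R"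
  shows "R \<one>\<^bsub>G\<^esub> = 1\<^sub>m n"
proof -
  interpret ring "ring_mat TYPE(complex) n ()" by (rule ring_mat)
  have "group (GL n)" unfolding GL_def by (rule units_group)
  then interpret group_hom G "GL n" R
    using assms by (simp add: group_hom_def group_hom_axioms_def representation_def)
  show ?thesis using hom_one by (simp add: GL_def units_of_def ring_mat_simps)
qed

text \<open>The span of the orbit of a nonzero vector is invariant, hence everything.\<close>

lemma irreducible_representation_dim_le_order:
  assumes G: "group G" and finG: "finite (carrier G)" and irr: "irreducible_representation G n R"
  shows "n \<le> card (carrier G)"
proof -
  interpret G: group G by (rule G)
  interpret vec_space "TYPE(complex)" n .
  have rep: "representation G n R" and n: "0 < n"
    using irr by (auto simp: irreducible_representation_def)
  let ?v = "unit_vec n 0 :: complex vec"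
  define S where "S = (\<lambda>g. R g *\<^sub>v ?v) ` carrier G"
  have S: "S \<subseteq> carrier_vec n" "finite S"
    using finG representation_carrier_mat[OF rep] by (auto simp: S_def intro!: mult_mat_vec_carrier)
  have orbit: "R g *\<^sub>v w \<in> S" if g: "g \<in> carrier G" and w: "w \<in> S" for g w
  proof -
    obtain h where h: "h \<in> carrier G" "w = R h *\<^sub>v ?v" using w by (auto simp: S_def)
    then have "R g *\<^sub>v w = R (g \<otimes>\<^bsub>G\<^esub> h) *\<^sub>v ?v"
      using g h representation_carrier_mat[OF rep]
      by (simp add: representation_mult[OF rep] assoc_mult_mat_vec[of _ n n _ n])
    then show ?thesis using g h by (auto simp: S_def)
  qed
  have "\<forall>g\<in>carrier G. \<forall>w\<in>span S. R g *\<^sub>v w \<in> span S"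
    by (intro ballI mult_mat_vec_span_invariant representation_carrier_mat[OF rep] S orbit)
  moreover have "VectorSpace.subspace class_ring (span S) V"
    using span_is_subspace S by simp
  ultimately have "span S = {0\<^sub>v n} \<or> span S = carrier_vec n"
    using irr by (simp add: irreducible_representation_def)
  moreover have "?v \<in> span S"
  proof -
    \<comment> \<open>The identity puts \<open>?v\<close> into its own orbit, which excludes the
      zero span.\<close>
    have "?v = R \<one>\<^bsub>G\<^esub> *\<^sub>v ?v" using representation_one[OF G rep] by simp
    then have "?v \<in> S" using G.one_closed unfolding S_def by blast
    then show ?thesis using in_own_span[of S] S by auto
  qed
  moreover have "?v \<noteq> 0\<^sub>v n"
    using n by (metis index_unit_vec(1) index_zero_vec(1) zero_neq_one)
  ultimately have "span S = carrier_vec n" by auto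
  then have "dim \<le> card S" using gen_ge_dim[of S] S by simp
  also have "\<dots> \<le> card (carrier G)" unfolding S_def using finG by (rule card_image_le)
  finally show ?thesis by (simp add: dim_is_n)
qed

text \<open>The character value at the identity is the trace of the identity matrix, so a degree is
  the dimension of its representation. Positivity matters for the finiteness of \<rho>(G): every
  prime divides 0, whereas a divisor of a positive degree is bounded by it.\<close>

lemma cd_bounds:
  assumes G: "group G" and fin: "finite (carrier G)" and d: "d \<in> cd G"
  shows "0 < d" "d \<le> card (carrier G)"
proof -
  obtain n R where irr: "irreducible_representation G n R"
    and d: "character_of G R \<one>\<^bsub>G\<^esub> = of_nat d"
    using d by (auto simp: cd_def Irr_def)
  then have "R \<one>\<^bsub>G\<^esub> = 1\<^sub>m n" and n: "0 < n"
    using representation_one[OF G] by (auto simp: irreducible_representation_def)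
  then have "d = n"
    using d G by (simp add: character_of_def mat_trace_def group.is_monoid monoid.one_closed)
  then show "0 < d" "d \<le> card (carrier G)"
    using n irreducible_representation_dim_le_order[OF G fin irr] by auto
qed

lemma finite_degree_primes:
  assumes "group G" "finite (carrier G)"
  shows "finite (degree_primes G)"
proof (rule finite_subset)
  show "degree_primes G \<subseteq> {..card (carrier G)}"
    unfolding degree_primes_def
    using cd_bounds[OF assms] dvd_imp_le le_trans by (blast intro: atMost_iff[THEN iffD2])
qed simp

section \<open>Cut vertices and reachability\<close>

text \<open>If all remaining vertices reached each other, deleting \<open>v\<close> would leave at
  most one component. The graph had at least one before, namely that of \<open>v\<close>, so the
  number could not have grown.\<close>

lemma cut_vertex_imp_unreachable:
  assumes "pair_bidirected_digraph \<Gamma>" "finite (pverts \<Gamma>)" "cut_vertex \<Gamma> v"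
  obtains (witness) x y where "x \<in> pverts \<Gamma> - {v}" "y \<in> pverts \<Gamma> - {v}"
    "\<not> x \<rightarrow>\<^sup>*\<^bsub>pre_digraph.del_vert (with_proj \<Gamma>) v\<^esub> y"
proof (rule ccontr)
  assume no: "\<not> thesis"
  have reach: "x \<rightarrow>\<^sup>*\<^bsub>pre_digraph.del_vert (with_proj \<Gamma>) v\<^esub> y"
    if "x \<in> pverts \<Gamma> - {v}" "y \<in> pverts \<Gamma> - {v}" for x y
    using no witness that by blast
  interpret pair_bidirected_digraph \<Gamma> by fact
  let ?H = "pre_digraph.del_vert (with_proj \<Gamma>) v"
  interpret H: wf_digraph ?H by (rule wf_digraph_del_vert)
  have vH: "verts ?H = pverts \<Gamma> - {v}" by (simp add: verts_del_vert)
  have "pre_digraph.sccs_verts ?H \<subseteq> {pverts \<Gamma> - {v}}"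
  proof
    fix S assume S: "S \<in> pre_digraph.sccs_verts ?H"
    then have "S \<subseteq> pverts \<Gamma> - {v}" using H.sccs_verts_subsets vH by auto
    then show "S \<in> {pverts \<Gamma> - {v}}"
      using S reach unfolding H.in_sccs_verts_conv_reachable by blast
  qed
  then have "card (pre_digraph.sccs_verts ?H) \<le> 1"
    using card_mono[of "{pverts \<Gamma> - {v}}"] by fastforce
  moreover have "v \<in> verts (with_proj \<Gamma>)" using assms(3) by (simp add: cut_vertex_def)
  then have "sccs_verts \<noteq> {}" using scc_of_in_sccs_verts[of v] by auto
  \<comment> \<open>Since \<open>card\<close> of an infinite set is 0, a nonempty family of
    components has positive cardinality only once it is known to be finite.\<close>
  moreover have "finite sccs_verts"
  proof (rule finite_subset)
    show "sccs_verts \<subseteq> Pow (pverts \<Gamma>)" using sccs_verts_subsets by auto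
  qed (simp add: assms)
  ultimately have "card (pre_digraph.sccs_verts ?H) \<le> 1" "0 < card sccs_verts"
    by (simp_all add: card_gt_0_iff)
  then show False using assms(3) unfolding cut_vertex_def by linarith
qed

section \<open>Distances and twins in blow-ups of paths\<close>

lemma metric_dim_eqI:
  assumes "resolving_set \<Gamma> W" "\<And>W'. resolving_set \<Gamma> W' \<Longrightarrow> card W \<le> card W'"
  shows "metric_dim \<Gamma> = card W"
  unfolding metric_dim_def using assms by (intro Least_equality) blast+

lemma card_ge_2_other:
  assumes "2 \<le> card A"
  shows "\<exists>y\<in>A. y \<noteq> x"
proof (rule ccontr)
  assume "\<not> ?thesis"
  then have "A \<subseteq> {x}" by blast
  then show False using card_mono[of "{x}" A] assms by simp
qed

text \<open>A path with every vertex replaced by a clique and every edge by a complete join;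
  \<open>l\<close> gives the position on the path.\<close>

locale path_blowup =
  fixes \<Gamma> :: "'v pair_pre_digraph" and l :: "'v \<Rightarrow> nat" and k :: nat
  assumes parcs_eq: "parcs \<Gamma> = {(u, v). u \<in> pverts \<Gamma> \<and> v \<in> pverts \<Gamma> \<and> u \<noteq> v \<and>
      l u \<le> Suc (l v) \<and> l v \<le> Suc (l u)}"
    and levels: "l ` pverts \<Gamma> = {..<k}"
begin

sublocale wf_digraph "with_proj \<Gamma>"
  by standard (auto simp: parcs_eq)

text \<open>Each arc changes the level by at most 1.\<close>

lemma awalk_cost_ge_level:
  assumes "awalk u p v"
  shows "\<bar>real (l u) - real (l v)\<bar> \<le> awalk_cost (\<lambda>_. 1) p"
  using assms
proof (induction p arbitrary: u)
  case Nil
  then show ?case by (simp add: awalk_Nil_iff)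
next
  case (Cons e p)
  then obtain w where "(u, w) \<in> parcs \<Gamma>" "awalk w p v"
    by (cases e) (auto simp: awalk_Cons_iff)
  then show ?case using Cons.IH[of w] by (auto simp: parcs_eq)
qed

lemma awalk_cost_ge_1:
  assumes "awalk u p v" "u \<noteq> v"
  shows "1 \<le> awalk_cost (\<lambda>_. 1) p"
  using assms pos_cost_pos_awalk_cost[of _ _ _ "\<lambda>_. 1"]
  by (cases p) (auto simp: awalk_Nil_iff awalk_Cons_iff)

text \<open>The walk moves one level at a time towards \<open>v\<close>. The maximum with 1 accounts
  for distinct vertices on the same level, which are adjacent.\<close>

lemma ex_awalk:
  assumes "u \<in> pverts \<Gamma>" "v \<in> pverts \<Gamma>" "u \<noteq> v"
  shows "\<exists>p. awalk u p v \<and> awalk_cost (\<lambda>_. 1) p = max 1 \<bar>real (l u) - real (l v)\<bar>"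
  using assms
proof (induction "nat \<bar>int (l u) - int (l v)\<bar>" arbitrary: u rule: less_induct)
  case less
  show ?case
  proof (cases "(u, v) \<in> parcs \<Gamma>")
    case True
    then have "awalk u [(u, v)] v" using less.prems by (auto simp: awalk_Cons_iff awalk_Nil_iff)
    then show ?thesis using True by (intro exI[of _ "[(u, v)]"]) (auto simp: parcs_eq)
  next
    case False
    \<comment> \<open>The next level towards \<open>v\<close>. It is occupied because the levels
      have no gaps. Vertices that are distinct and not adjacent differ by at least two levels, so
      the new vertex \<open>w\<close> is still off the level of \<open>v\<close> and the induction
      hypothesis applies to it.\<close>
    define m where "m = (if l u < l v then l u + 1 else l u - 1)"
    have far: "l u + 1 < l v \<or> l v + 1 < l u" using False less.prems by (auto simp: parcs_eq)
    have "l u < k" "l v < k" using less.prems levels by auto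
    then have "m \<in> l ` pverts \<Gamma>" using far unfolding levels m_def by auto
    then obtain w where w: "w \<in> pverts \<Gamma>" "l w = m" by auto
    have uw: "(u, w) \<in> parcs \<Gamma>" using w less.prems far by (auto simp: parcs_eq m_def)
    obtain p where p: "awalk w p v" "awalk_cost (\<lambda>_. 1) p = max 1 \<bar>real (l w) - real (l v)\<bar>"
    proof -
      have "l w \<noteq> l v" "nat \<bar>int (l w) - int (l v)\<bar> < nat \<bar>int (l u) - int (l v)\<bar>"
        using w far by (auto simp: m_def)
      then show ?thesis using less.hyps[of w] w less.prems that by auto
    qed
    have "awalk u ((u, w) # p) v" using p uw less.prems by (auto simp: awalk_Cons_iff)
    moreover have "awalk_cost (\<lambda>_. 1) ((u, w) # p) = max 1 \<bar>real (l u) - real (l v)\<bar>"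
      using p w far by (auto simp: m_def)
    ultimately show ?thesis by blast
  qed
qed

text \<open>The empty walk or the walk of \<open>ex_awalk\<close> gives the upper bound; the lower
  bound holds because costs are nonnegative, walks between distinct vertices have an arc, and each
  arc crosses at most one level.\<close>

lemma gdist_eq:
  assumes "u \<in> pverts \<Gamma>" "v \<in> pverts \<Gamma>"
  shows "gdist \<Gamma> u v = ereal (if u = v then 0 else max 1 \<bar>real (l u) - real (l v)\<bar>)" (is "_ = ?d")
proof (rule antisym)
  show "gdist \<Gamma> u v \<le> ?d"
  proof (cases "u = v")
    case True
    then have "awalk u [] v" using assms by (simp add: awalk_Nil_iff)
    from min_cost_le_walk_cost[OF this] show ?thesis using True by (simp add: gdist_def)
  next
    case False
    then show ?thesis using ex_awalk[OF assms] min_cost_le_walk_cost unfolding gdist_def by metis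
  qed
  show "?d \<le> gdist \<Gamma> u v"
    unfolding gdist_def \<mu>_def
    using awalk_cost_ge_1 awalk_cost_ge_level pos_cost_pos_awalk_cost[of _ _ _ "\<lambda>_. 1"]
    by (auto intro!: INF_greatest)
qed

lemma metric_rep_eq_iff:
  "metric_rep \<Gamma> W x = metric_rep \<Gamma> W y \<longleftrightarrow> (\<forall>w\<in>W. gdist \<Gamma> x w = gdist \<Gamma> y w)"
  by (auto simp: metric_rep_def fun_eq_iff restrict_def)

text \<open>Two vertices on the same level are twins, so only themselves tell them apart.\<close>

lemma resolving_set_inj_on_level:
  assumes "resolving_set \<Gamma> W"
  shows "inj_on l (pverts \<Gamma> - W)"
proof (rule inj_onI)
  fix x y assume xy: "x \<in> pverts \<Gamma> - W" "y \<in> pverts \<Gamma> - W" "l x = l y"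
  then have "gdist \<Gamma> x w = gdist \<Gamma> y w" if "w \<in> W" for w
    using that assms gdist_eq[of x w] gdist_eq[of y w] by (auto simp: resolving_set_def)
  then show "x = y" using assms xy by (auto simp: resolving_set_def inj_on_def metric_rep_eq_iff)
qed

text \<open>A landmark is recognized by its distance 0 to itself, so only vertices outside a set of
  landmarks can share a representation.\<close>

lemma gdist_self_neq:
  assumes "x \<in> pverts \<Gamma>" "y \<in> pverts \<Gamma>" "x \<noteq> y"
  shows "gdist \<Gamma> y x \<noteq> gdist \<Gamma> x x"
  using assms by (auto simp: gdist_eq simp del: ereal_max)

end

section \<open>Metric dimension of a blow-up of the path with four vertices\<close>

text \<open>Levels 0 to 3 will be \<rho>1, \<open>{v}\<close>, \<rho>3 and \<rho>4. With two
  vertices on level 2, one can be left out of a resolving set while another stays as a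
  landmark.\<close>

locale path_blowup4 = path_blowup \<Gamma> l 4 for \<Gamma> :: "'v pair_pre_digraph" and l +
  assumes fin: "finite (pverts \<Gamma>)"
    and card_level1: "card {v \<in> pverts \<Gamma>. l v = 1} = 1"
    and card_level2: "2 \<le> card {v \<in> pverts \<Gamma>. l v = 2}"
begin

lemma level_less: "v \<in> pverts \<Gamma> \<Longrightarrow> l v < 4"
  using levels by auto

lemma level_ex: "i < 4 \<Longrightarrow> \<exists>v. v \<in> pverts \<Gamma> \<and> l v = i"
  using levels by (metis imageE lessThan_iff)

text \<open>For vertices outside \<open>W\<close> on levels 0, 1, 2, 3, the pairs of distances to
  \<open>a\<close> and \<open>c\<close> are (1,2), (1,1), (2,1), (3,1). These landmarks thus
  determine the level, and on each level at most one vertex lies outside \<open>W\<close>.\<close>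

lemma resolving_setI:
  assumes W: "W \<subseteq> pverts \<Gamma>" and inj: "inj_on l (pverts \<Gamma> - W)"
    and a: "a \<in> W" "l a = 0" and c: "c \<in> W" "l c = 2"
  shows "resolving_set \<Gamma> W"
  unfolding resolving_set_def
proof (intro conjI inj_onI)
  show "finite W" using W fin by (rule finite_subset)
  fix x y assume x: "x \<in> pverts \<Gamma>" and y: "y \<in> pverts \<Gamma>"
    and eq: "metric_rep \<Gamma> W x = metric_rep \<Gamma> W y"
  then have eq: "gdist \<Gamma> x w = gdist \<Gamma> y w" if "w \<in> W" for w
    using that by (simp add: metric_rep_eq_iff)
  show "x = y"
  proof (rule ccontr)
    assume "x \<noteq> y"
    then have out: "x \<notin> W" "y \<notin> W"
      using eq x y gdist_self_neq[of x y] gdist_self_neq[of y x] by auto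
    have ne: "x \<noteq> a" "y \<noteq> a" "x \<noteq> c" "y \<noteq> c" using out a c by auto
    have ac: "a \<in> pverts \<Gamma>" "c \<in> pverts \<Gamma>" using a c W by auto
    have "max 1 (real (l x)) = max 1 (real (l y))"
      using eq[OF a(1)] ne a(2) x y ac by (simp add: gdist_eq del: ereal_max)
    moreover have "max 1 \<bar>real (l x) - 2\<bar> = max 1 \<bar>real (l y) - 2\<bar>"
      using eq[OF c(1)] ne c(2) x y ac by (simp add: gdist_eq del: ereal_max)
    \<comment> \<open>The distance to \<open>a\<close> confuses only levels 0 and 1; the distance to
      \<open>c\<close> is 2 on the former and 1 on the latter.\<close>
    ultimately have "l x = l y" by (auto simp: max_def abs_if split: if_splits)
    then show False using inj out x y \<open>x \<noteq> y\<close> by (auto dest: inj_onD)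
  qed
qed (use W in auto)

text \<open>The complement of \<open>W\<close> injects into the four levels. If it met all four
  while levels 0 and 1 are singletons, every landmark would lie on level 2 or 3, and the two missing
  vertices on these levels would have distance 1 to all landmarks.\<close>

lemma card_resolving_set_ge:
  assumes "resolving_set \<Gamma> W"
  shows "card (pverts \<Gamma>) \<le> card W + 4"
    and "card {v \<in> pverts \<Gamma>. l v = 0} = 1 \<Longrightarrow> card (pverts \<Gamma>) \<le> card W + 3"
proof -
  have W: "W \<subseteq> pverts \<Gamma>" "finite W" using assms by (auto simp: resolving_set_def)
  have inj: "inj_on l (pverts \<Gamma> - W)" using assms by (rule resolving_set_inj_on_level)
  have sub: "l ` (pverts \<Gamma> - W) \<subseteq> {..<4}" using level_less by auto
  have card: "card (l ` (pverts \<Gamma> - W)) = card (pverts \<Gamma>) - card W"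
    using card_image[OF inj] W by (simp add: card_Diff_subset)
  show ge4: "card (pverts \<Gamma>) \<le> card W + 4"
    using card_mono[OF _ sub] card by simp
  assume lev0: "card {v \<in> pverts \<Gamma>. l v = 0} = 1"
  show "card (pverts \<Gamma>) \<le> card W + 3"
  proof (rule ccontr)
    assume "\<not> ?thesis"
    \<comment> \<open>Together with \<open>ge4\<close>, the negated bound says that exactly four
      vertices are missing, one per level.\<close>
    then have "card (l ` (pverts \<Gamma> - W)) = card {..<4::nat}" using ge4 card by simp
    then have all: "l ` (pverts \<Gamma> - W) = {..<4}" using sub by (simp add: card_subset_eq)
    have ex: "\<exists>v \<in> pverts \<Gamma> - W. l v = i" if "i < 4" for i
      using that all by (metis imageE lessThan_iff)
    obtain a where a: "{v \<in> pverts \<Gamma>. l v = 0} = {a}" using lev0 by (auto simp: card_1_singleton_iff)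
    obtain b where b: "{v \<in> pverts \<Gamma>. l v = 1} = {b}"
      using card_level1 by (auto simp: card_1_singleton_iff)
    have ab: "a \<notin> W" "b \<notin> W" using ex[of 0] ex[of 1] a b by auto
    obtain c d where c: "c \<in> pverts \<Gamma> - W" "l c = 2" and d: "d \<in> pverts \<Gamma> - W" "l d = 3"
      using ex[of 2] ex[of 3] by auto
    have "gdist \<Gamma> c w = gdist \<Gamma> d w" if w: "w \<in> W" for w
    proof -
      have "l w \<noteq> 0" "l w \<noteq> 1" using a b ab w W by auto
      then have "l w = 2 \<or> l w = 3" using level_less[of w] w W by auto
      then show ?thesis using w W c d by (auto simp: gdist_eq)
    qed
    then have "c = d" using assms c d by (auto simp: resolving_set_def inj_on_def metric_rep_eq_iff)
    then show False using c d by simp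
  qed
qed

text \<open>One vertex is omitted on each of the levels 1, 2 and 3. The only vertex \<open>a\<close>
  on level 0 and a second vertex \<open>c'\<close> on level 2 stay as the landmarks that
  \<open>resolving_setI\<close> asks for.\<close>

lemma metric_dim_singleton_end:
  assumes "card {v \<in> pverts \<Gamma>. l v = 0} = 1"
  shows "metric_dim \<Gamma> + 3 = card (pverts \<Gamma>)"
proof -
  obtain a b c d where a: "a \<in> pverts \<Gamma>" "l a = 0" and b: "b \<in> pverts \<Gamma>" "l b = 1"
    and c: "c \<in> pverts \<Gamma>" "l c = 2" and d: "d \<in> pverts \<Gamma>" "l d = 3"
    using level_ex[of 0] level_ex[of 1] level_ex[of 2] level_ex[of 3] by auto
  obtain c' where c': "c' \<in> pverts \<Gamma>" "l c' = 2" "c' \<noteq> c"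
    using card_ge_2_other[OF card_level2, of c] c by auto
  let ?W = "pverts \<Gamma> - {b, c, d}"
  have "resolving_set \<Gamma> ?W"
  proof (rule resolving_setI)
    show "a \<in> ?W" "c' \<in> ?W" using a b c c' d by auto
    show "inj_on l (pverts \<Gamma> - ?W)" using b c d by (auto simp: inj_on_def)
  qed (use a c' in auto)
  moreover have "b \<noteq> c" "b \<noteq> d" "c \<noteq> d" using b c d by auto
  then have card: "card ?W + 3 = card (pverts \<Gamma>)"
    using b c d fin card_mono[of "pverts \<Gamma>" "{b, c, d}"] by (simp add: card_Diff_subset)
  ultimately have "metric_dim \<Gamma> = card ?W"
    using card_resolving_set_ge(2)[OF _ assms]
    by (intro metric_dim_eqI) (simp_all flip: card)
  then show ?thesis using card by simp
qed

text \<open>A second vertex \<open>a'\<close> on level 0 takes over as landmark, so \<open>a\<close>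
  can be omitted as well.\<close>

lemma metric_dim_nonsingleton_end:
  assumes "2 \<le> card {v \<in> pverts \<Gamma>. l v = 0}"
  shows "metric_dim \<Gamma> + 4 = card (pverts \<Gamma>)"
proof -
  obtain a b c d where a: "a \<in> pverts \<Gamma>" "l a = 0" and b: "b \<in> pverts \<Gamma>" "l b = 1"
    and c: "c \<in> pverts \<Gamma>" "l c = 2" and d: "d \<in> pverts \<Gamma>" "l d = 3"
    using level_ex[of 0] level_ex[of 1] level_ex[of 2] level_ex[of 3] by auto
  obtain c' where c': "c' \<in> pverts \<Gamma>" "l c' = 2" "c' \<noteq> c"
    using card_ge_2_other[OF card_level2, of c] c by auto
  obtain a' where a': "a' \<in> pverts \<Gamma>" "l a' = 0" "a' \<noteq> a"
    using card_ge_2_other[OF assms, of a] a by auto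
  let ?W = "pverts \<Gamma> - {a, b, c, d}"
  have "resolving_set \<Gamma> ?W"
  proof (rule resolving_setI)
    show "a' \<in> ?W" "c' \<in> ?W" using a a' b c c' d by auto
    show "inj_on l (pverts \<Gamma> - ?W)" using a b c d by (auto simp: inj_on_def)
  qed (use a' c' in auto)
  moreover have "a \<noteq> b" "a \<noteq> c" "a \<noteq> d" "b \<noteq> c" "b \<noteq> d" "c \<noteq> d" using a b c d by auto
  then have card: "card ?W + 4 = card (pverts \<Gamma>)"
    using a b c d fin card_mono[of "pverts \<Gamma>" "{a, b, c, d}"] by (simp add: card_Diff_subset)
  ultimately have "metric_dim \<Gamma> = card ?W"
    using card_resolving_set_ge(1)
    by (intro metric_dim_eqI) (simp_all flip: card)
  then show ?thesis using card by simp
qed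

end

section \<open>From Lewis' partition to the path blow-up\<close>

text \<open>Otherwise some edge between the two cliques avoids \<open>v\<close>. It still joins what
  is left of them after \<open>v\<close> is deleted, so the remaining graph is connected.\<close>

lemma lewis_partition_cut_vertex:
  assumes bi: "pair_bidirected_digraph \<Gamma>" and fin: "finite (pverts \<Gamma>)"
    and lewis: "lewis_partition \<Gamma> \<rho>1 \<rho>2 \<rho>3 \<rho>4" and cut: "cut_vertex \<Gamma> v"
  shows "\<rho>2 = {v}"
proof (rule ccontr)
  assume ne: "\<rho>2 \<noteq> {v}"
  interpret pair_bidirected_digraph \<Gamma> by fact
  let ?H = "pre_digraph.del_vert (with_proj \<Gamma>) v"
  interpret H: wf_digraph ?H by (rule wf_digraph_del_vert)
  have V: "pverts \<Gamma> = \<rho>1 \<union> \<rho>2 \<union> \<rho>3 \<union> \<rho>4" and "\<rho>2 \<noteq> {}" "\<rho>2 \<inter> \<rho>3 = {}" "3 \<le> card \<rho>3"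
    and r23: "\<forall>u\<in>\<rho>2. \<exists>w\<in>\<rho>3. (u, w) \<in> parcs \<Gamma>"
    and r32: "\<forall>w\<in>\<rho>3. \<exists>u\<in>\<rho>2. (w, u) \<in> parcs \<Gamma>"
    and cA: "induces_complete \<Gamma> (\<rho>1 \<union> \<rho>2)" and cB: "induces_complete \<Gamma> (\<rho>3 \<union> \<rho>4)"
    using lewis by (simp_all add: lewis_partition_def)
  have sym: "(y, x) \<in> parcs \<Gamma>" if "(x, y) \<in> parcs \<Gamma>" for x y
    using that arcs_symmetric by blast
  \<comment> \<open>If \<open>v\<close> lies in \<rho>2, the edge starts at another vertex of
    \<rho>2, and its end in \<rho>3 differs from \<open>v\<close> by disjointness. If not, it starts
    at a vertex of \<rho>3 other than \<open>v\<close>, and its end in \<rho>2 differs from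
    \<open>v\<close>.\<close>
  obtain u w where uw: "u \<in> \<rho>2 - {v}" "w \<in> \<rho>3 - {v}" "(u, w) \<in> parcs \<Gamma>"
  proof (cases "v \<in> \<rho>2")
    case True
    then obtain u where "u \<in> \<rho>2" "u \<noteq> v" using ne by blast
    then show ?thesis using that r23 True \<open>\<rho>2 \<inter> \<rho>3 = {}\<close> by blast
  next
    case False
    have "\<not> \<rho>3 \<subseteq> {v}" using card_mono[of "{v}" \<rho>3] \<open>3 \<le> card \<rho>3\<close> by auto
    then show ?thesis using that r32 False sym by blast
  qed
  have arc: "x \<rightarrow>\<^sup>*\<^bsub>?H\<^esub> y" if "(x, y) \<in> parcs \<Gamma>" "x \<noteq> v" "y \<noteq> v" for x y
  proof -
    have "(x, y) \<in> arcs ?H" using that by (simp add: arcs_del_vert)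
    then have "x \<rightarrow>\<^bsub>?H\<^esub> y" using H.in_arcs_imp_in_arcs_ends[of "(x, y)"] by (simp add: tail_del_vert head_del_vert)
    then show ?thesis by (rule H.reachable_adjI)
  qed
  have clique: "x \<rightarrow>\<^sup>*\<^bsub>?H\<^esub> y"
    if "x \<in> S - {v}" "y \<in> S - {v}" "induces_complete \<Gamma> S" "S \<subseteq> pverts \<Gamma>" for x y S
  proof (cases "x = y")
    case True
    then show ?thesis using that(1,4) by (auto simp: verts_del_vert)
  next
    case False
    then have "(x, y) \<in> parcs \<Gamma>" using that(1-3) by (simp add: induces_complete_def)
    then show ?thesis using that(1,2) arc by simp
  qed
  have uw_reach: "u \<rightarrow>\<^sup>*\<^bsub>?H\<^esub> w" "w \<rightarrow>\<^sup>*\<^bsub>?H\<^esub> u" using uw arc sym by auto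
  have sub: "\<rho>1 \<union> \<rho>2 \<subseteq> pverts \<Gamma>" "\<rho>3 \<union> \<rho>4 \<subseteq> pverts \<Gamma>" using V by auto
  \<comment> \<open>The vertex \<open>u\<close> serves as a hub: its own clique reaches it directly,
    the other one through \<open>w\<close>. Both directions are recorded because reachability is
    directed.\<close>
  have to_u: "x \<rightarrow>\<^sup>*\<^bsub>?H\<^esub> u \<and> u \<rightarrow>\<^sup>*\<^bsub>?H\<^esub> x" if "x \<in> pverts \<Gamma> - {v}" for x
  proof (cases "x \<in> \<rho>1 \<union> \<rho>2")
    case True
    then show ?thesis using clique[OF _ _ cA sub(1), of x u] clique[OF _ _ cA sub(1), of u x] that uw by auto
  next
    case False
    then have "x \<in> \<rho>3 \<union> \<rho>4 - {v}" using that V by auto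
    then have "x \<rightarrow>\<^sup>*\<^bsub>?H\<^esub> w" "w \<rightarrow>\<^sup>*\<^bsub>?H\<^esub> x"
      using clique[OF _ _ cB sub(2), of x w] clique[OF _ _ cB sub(2), of w x] uw by auto
    then show ?thesis using uw_reach H.reachable_trans by blast
  qed
  obtain x y where "x \<in> pverts \<Gamma> - {v}" "y \<in> pverts \<Gamma> - {v}" "\<not> x \<rightarrow>\<^sup>*\<^bsub>?H\<^esub> y"
    using cut_vertex_imp_unreachable[OF bi fin cut] .
  then show False using to_u H.reachable_trans by blast
qed

text \<open>The default 3 stands for \<rho>4, the only part of the vertex set left over.\<close>

definition lewis_level :: "'v set \<Rightarrow> 'v set \<Rightarrow> 'v set \<Rightarrow> 'v \<Rightarrow> nat" where
  "lewis_level \<rho>1 \<rho>2 \<rho>3 v = (if v \<in> \<rho>1 then 0 else if v \<in> \<rho>2 then 1 else if v \<in> \<rho>3 then 2 else 3)"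

text \<open>Arcs inside the two cliques are all present, and the partition forbids those between
  levels at least two apart. The join of \<rho>2 and \<rho>3 is complete because \<rho>2 has only
  one vertex.\<close>

lemma lewis_partition_path_blowup4:
  assumes bi: "pair_bidirected_digraph \<Gamma>" and fin: "finite (pverts \<Gamma>)"
    and lewis: "lewis_partition \<Gamma> \<rho>1 \<rho>2 \<rho>3 \<rho>4" and cut: "cut_vertex \<Gamma> v"
  shows "path_blowup4 \<Gamma> (lewis_level \<rho>1 \<rho>2 \<rho>3)"
    and "{x \<in> pverts \<Gamma>. lewis_level \<rho>1 \<rho>2 \<rho>3 x = 0} = \<rho>1"
proof -
  interpret pair_bidirected_digraph \<Gamma> by fact
  let ?l = "lewis_level \<rho>1 \<rho>2 \<rho>3"
  have r2: "\<rho>2 = {v}" by (rule lewis_partition_cut_vertex) fact+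
  have V: "pverts \<Gamma> = \<rho>1 \<union> \<rho>2 \<union> \<rho>3 \<union> \<rho>4"
    and disj: "\<rho>1 \<inter> \<rho>2 = {}" "\<rho>1 \<inter> \<rho>3 = {}" "\<rho>1 \<inter> \<rho>4 = {}" "\<rho>2 \<inter> \<rho>3 = {}" "\<rho>2 \<inter> \<rho>4 = {}" "\<rho>3 \<inter> \<rho>4 = {}"
    and ne: "\<rho>1 \<noteq> {}" "\<rho>3 \<noteq> {}" "\<rho>4 \<noteq> {}" and c3: "3 \<le> card \<rho>3"
    and n1_all: "\<forall>x\<in>\<rho>1. \<forall>y\<in>\<rho>3 \<union> \<rho>4. (x, y) \<notin> parcs \<Gamma>"
    and n4_all: "\<forall>x\<in>\<rho>4. \<forall>y\<in>\<rho>1 \<union> \<rho>2. (x, y) \<notin> parcs \<Gamma>"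
    and r32_all: "\<forall>w\<in>\<rho>3. \<exists>u\<in>\<rho>2. (w, u) \<in> parcs \<Gamma>"
    and complete: "induces_complete \<Gamma> (\<rho>1 \<union> \<rho>2)" "induces_complete \<Gamma> (\<rho>3 \<union> \<rho>4)"
    using lewis unfolding lewis_partition_def by simp_all
  have n1: "(x, y) \<notin> parcs \<Gamma>" if "x \<in> \<rho>1" "y \<in> \<rho>3 \<union> \<rho>4" for x y using n1_all that by blast
  have n4: "(x, y) \<notin> parcs \<Gamma>" if "x \<in> \<rho>4" "y \<in> \<rho>1 \<union> \<rho>2" for x y using n4_all that by blast
  \<comment> \<open>As \<rho>2 is \<open>{v}\<close>, having some neighbour in \<rho>2 means being
    adjacent to \<open>v\<close>.\<close>
  have r32: "(w, v) \<in> parcs \<Gamma>" if "w \<in> \<rho>3" for w using r32_all r2 that by blast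
  have cA: "(x, y) \<in> parcs \<Gamma>" if "x \<in> \<rho>1 \<union> \<rho>2" "y \<in> \<rho>1 \<union> \<rho>2" "x \<noteq> y" for x y
    using complete(1) that unfolding induces_complete_def by blast
  have cB: "(x, y) \<in> parcs \<Gamma>" if "x \<in> \<rho>3 \<union> \<rho>4" "y \<in> \<rho>3 \<union> \<rho>4" "x \<noteq> y" for x y
    using complete(2) that unfolding induces_complete_def by blast
  have sym: "(x, y) \<in> parcs \<Gamma> \<longleftrightarrow> (y, x) \<in> parcs \<Gamma>" for x y
    using arcs_symmetric by blast
  have l: "x \<in> \<rho>1 \<Longrightarrow> ?l x = 0" "x \<in> \<rho>2 \<Longrightarrow> ?l x = 1" "x \<in> \<rho>3 \<Longrightarrow> ?l x = 2" "x \<in> \<rho>4 \<Longrightarrow> ?l x = 3" for x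
    using disj by (auto simp: lewis_level_def)
  have arc_iff: "(x, y) \<in> parcs \<Gamma> \<longleftrightarrow> x \<noteq> y \<and> ?l x \<le> Suc (?l y) \<and> ?l y \<le> Suc (?l x)"
    if x: "x \<in> pverts \<Gamma>" and y: "y \<in> pverts \<Gamma>" for x y
  proof -
    have irrefl: "(z, z) \<notin> parcs \<Gamma>" for z using no_loops' by blast
    have n1': "(z, w) \<notin> parcs \<Gamma>" if "w \<in> \<rho>1" "z \<in> \<rho>3 \<union> \<rho>4" for w z
      using that n1 sym by blast
    have n4': "(z, w) \<notin> parcs \<Gamma>" if "w \<in> \<rho>4" "z \<in> \<rho>1 \<union> \<rho>2" for w z
      using that n4 sym by blast
    have j: "(w, z) \<in> parcs \<Gamma>" "(z, w) \<in> parcs \<Gamma>" if "w \<in> \<rho>3" "z \<in> \<rho>2" for w z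
      using that r32 r2 sym by auto
    have ne: "x \<noteq> y" if "x \<in> \<rho>3 \<and> y \<in> \<rho>2 \<or> x \<in> \<rho>2 \<and> y \<in> \<rho>3" using that disj by auto
    have "x \<in> \<rho>1 \<or> x \<in> \<rho>2 \<or> x \<in> \<rho>3 \<or> x \<in> \<rho>4" "y \<in> \<rho>1 \<or> y \<in> \<rho>2 \<or> y \<in> \<rho>3 \<or> y \<in> \<rho>4"
      using x y V by auto
    then show ?thesis
      \<comment> \<open>One case for each of the 16 pairs of parts containing \<open>x\<close> and
        \<open>y\<close>.\<close>
      by (elim disjE; cases "x = y")
        (simp_all add: l irrefl n1 n1' n4 n4' j cA cB ne)
  qed
  have lev: "{x \<in> pverts \<Gamma>. ?l x = 0} = \<rho>1" "{x \<in> pverts \<Gamma>. ?l x = 1} = \<rho>2"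
    "{x \<in> pverts \<Gamma>. ?l x = 2} = \<rho>3"
    using V disj by (auto simp: lewis_level_def)
  show "{x \<in> pverts \<Gamma>. ?l x = 0} = \<rho>1" by (fact lev)
  show "path_blowup4 \<Gamma> ?l"
  proof
    show "parcs \<Gamma> = {(x, y). x \<in> pverts \<Gamma> \<and> y \<in> pverts \<Gamma> \<and> x \<noteq> y \<and>
        ?l x \<le> Suc (?l y) \<and> ?l y \<le> Suc (?l x)}"
      using arc_iff in_arcsD1 in_arcsD2 by fast
    have "?l ` \<rho>1 = {0}" "?l ` \<rho>2 = {1}" "?l ` \<rho>3 = {2}" "?l ` \<rho>4 = {3}"
      using l ne r2 by force+
    then show "?l ` pverts \<Gamma> = {..<4}" unfolding V image_Un by auto
    show "finite (pverts \<Gamma>)" by (fact fin)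
    show "card {x \<in> pverts \<Gamma>. ?l x = 1} = 1" unfolding lev(2) using r2 by simp
    show "2 \<le> card {x \<in> pverts \<Gamma>. ?l x = 2}" unfolding lev(3) using c3 by simp
  qed
qed

theorem theorem3p5:
  fixes G :: "('a, 'b) monoid_scheme" and n :: nat
    and \<rho>1 \<rho>2 \<rho>3 \<rho>4 :: "nat set"
  assumes "group G" and "finite (carrier G)" and "solvable G"
    and "card (pverts (degree_graph G)) = n"
    and "diameter (degree_graph G) = 3"
    and "lewis_partition (degree_graph G) \<rho>1 \<rho>2 \<rho>3 \<rho>4"
    and "\<exists>v. cut_vertex (degree_graph G) v"
  shows "(card \<rho>1 = 1 \<longrightarrow> int (metric_dim (degree_graph G)) = int n - 3) \<and>
         (2 \<le> card \<rho>1 \<longrightarrow> int (metric_dim (degree_graph G)) = int n - 4)"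
proof -
  obtain v where v: "cut_vertex (degree_graph G) v" using assms by blast
  have "finite (pverts (degree_graph G))"
    using finite_degree_primes assms by (simp add: degree_graph_def)
  note blowup = lewis_partition_path_blowup4[OF pair_bidirected_digraph_degree_graph this assms(6) v]
  interpret path_blowup4 "degree_graph G" "lewis_level \<rho>1 \<rho>2 \<rho>3" by (fact blowup(1))
  \<comment> \<open>Level 0 is \<rho>1, so its size decides which formula applies; the additive
    equations over the naturals yield the integer differences.\<close>
  show ?thesis
    using metric_dim_singleton_end metric_dim_nonsingleton_end
    unfolding blowup(2) assms(4) by linarith
qed

end
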